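(* The strong Legendre conjecture implies the strong Brocard conjecture, which in turn implies the standard Brocard conjecture.
   Context: $p_n$ denotes the $n$-th prime and $g_n := p_{n+1}-p_n$ denotes the $n$-th prime gap. The conjectures are as follows. Strong Legendre conjecture: there are at least two primes in the interval $\left(m^2,(m+1)^2\right)$, where $m$ is an integer. Strong Brocard conjecture: there are at least $2g_n := 2(p_{n+1}-p_n)$ primes in the interval $\left(p_n^2,p_{n+1}^2\right)$. Standard Brocard conjecture: there are at least four primes in the interval $\left(p_n^2,p_{n+1}^2\right)$.
   Formalization: The standard Brocard conjecture is taken for n ≥ 2, since (p_1^2, p_2^2) = (4, 9) contains only the two primes 5 and 7; the strong Legendre conjecture is taken for m ≥ 1, since (0, 1) contains no primes. *)

theory Defs
  imports "HOL-Computational_Algebra.Primes" "HOL-Library.Infinite_Set"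
begin

text \<open>The primes are numbered from 1, while \<^const>\<open>enumerate\<close> counts from 0.
  The value at \<open>n = 0\<close> is junk.\<close>

definition nth_prime :: "nat \<Rightarrow> nat" where
  "nth_prime n = enumerate {p. prime p} (n - 1)"

text \<open>The subtraction does not truncate, as \<^const>\<open>nth_prime\<close> is increasing.\<close>

definition prime_gap :: "nat \<Rightarrow> nat" where
  "prime_gap n = nth_prime (n + 1) - nth_prime n"

definition primes_between :: "nat \<Rightarrow> nat \<Rightarrow> nat" where
  "primes_between a b = card {p \<in> {a<..<b}. prime p}"

text \<open>For \<open>m = 0\<close> the interval \<open>(0, 1)\<close> contains no primes, so \<open>m\<close> ranges over
  the positive integers.\<close>

definition strong_Legendre :: bool where
  "strong_Legendre \<longleftrightarrow> (\<forall>m\<ge>1. primes_between (m\<^sup>2) ((m + 1)\<^sup>2) \<ge> 2)"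

definition strong_Brocard :: bool where
  "strong_Brocard \<longleftrightarrow>
    (\<forall>n\<ge>1. primes_between ((nth_prime n)\<^sup>2) ((nth_prime (n + 1))\<^sup>2) \<ge> 2 * prime_gap n)"

text \<open>The index starts at 2 here: between \<open>2\<^sup>2\<close> and \<open>3\<^sup>2\<close> there are only the two
  primes 5 and 7.\<close>

definition standard_Brocard :: bool where
  "standard_Brocard \<longleftrightarrow>
    (\<forall>n\<ge>2. primes_between ((nth_prime n)\<^sup>2) ((nth_prime (n + 1))\<^sup>2) \<ge> 4)"

end

theory Submission
  imports Defs
begin

text \<open>The points \<open>m\<^sup>2\<close> with \<open>p\<^sub>n \<le> m \<le> p\<^sub>n\<^sub>+\<^sub>1\<close> cut the interval between \<open>p\<^sub>n\<^sup>2\<close> and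
  \<open>p\<^sub>n\<^sub>+\<^sub>1\<^sup>2\<close> into \<open>g\<^sub>n\<close> disjoint intervals between consecutive squares. Each of these contains
  two primes by the strong Legendre conjecture, which gives the \<open>2 g\<^sub>n\<close> primes of the strong
  Brocard conjecture (\<open>strong_Legendre_telescoped\<close>). For the second implication, both
  \<open>p\<^sub>n\<close> and \<open>p\<^sub>n\<^sub>+\<^sub>1\<close> are odd if \<open>n \<ge> 2\<close>, so \<open>g\<^sub>n\<close> is a positive even number and
  \<open>2 g\<^sub>n \<ge> 4\<close> (\<open>prime_gap_ge_2\<close>).\<close>

lemma primes_between_superadditive:
  assumes "a \<le> b" "b \<le> c"
  shows "primes_between a b + primes_between b c \<le> primes_between a c"
proof -
  have "primes_between a b + primes_between b c
      = card ({p \<in> {a<..<b}. prime p} \<union> {p \<in> {b<..<c}. prime p})"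
    unfolding primes_between_def by (rule card_Un_disjoint [symmetric]) auto
  also have "\<dots> \<le> primes_between a c"
    unfolding primes_between_def by (rule card_mono) (use assms in auto)
  finally show ?thesis .
qed

lemma strong_Legendre_telescoped:
  assumes "strong_Legendre" "a \<ge> 1"
  shows "2 * d \<le> primes_between (a\<^sup>2) ((a + d)\<^sup>2)"
proof (induction d)
  case 0
  show ?case by simp
next
  case (Suc d)
  have "2 \<le> primes_between ((a + d)\<^sup>2) ((a + d + 1)\<^sup>2)"
    using assms unfolding strong_Legendre_def by simp
  moreover have "primes_between (a\<^sup>2) ((a + d)\<^sup>2) + primes_between ((a + d)\<^sup>2) ((a + d + 1)\<^sup>2)
      \<le> primes_between (a\<^sup>2) ((a + d + 1)\<^sup>2)"
    by (intro primes_between_superadditive power_mono) auto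
  ultimately show ?case using Suc.IH by simp
qed

lemma prime_nth_prime: "prime (nth_prime n)"
  using enumerate_in_set [OF primes_infinite] unfolding nth_prime_def by blast

lemma nth_prime_less:
  assumes "1 \<le> m" "m < n"
  shows "nth_prime m < nth_prime n"
  unfolding nth_prime_def by (rule enumerate_mono) (use assms primes_infinite in auto)

lemma odd_nth_prime:
  assumes "n \<ge> 2"
  shows "odd (nth_prime n)"
proof -
  have "2 \<le> nth_prime 1"
    by (rule prime_ge_2_nat [OF prime_nth_prime])
  also have "\<dots> < nth_prime n"
    by (rule nth_prime_less) (use assms in auto)
  finally show ?thesis by (rule prime_odd_nat [OF prime_nth_prime])
qed

lemma prime_gap_ge_2:
  assumes "n \<ge> 2"
  shows "prime_gap n \<ge> 2"
proof -
  have "nth_prime n < nth_prime (n + 1)"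
    by (rule nth_prime_less) (use assms in auto)
  moreover have "odd (nth_prime n)" "odd (nth_prime (n + 1))"
    by (rule odd_nth_prime, use assms in simp)+
  ultimately show ?thesis unfolding prime_gap_def by presburger
qed

theorem mainTheorem3:
  shows "(strong_Legendre \<longrightarrow> strong_Brocard) \<and> (strong_Brocard \<longrightarrow> standard_Brocard)"
proof (intro conjI impI)
  assume L: "strong_Legendre"
  show "strong_Brocard"
    unfolding strong_Brocard_def
  proof (intro allI impI)
    fix n :: nat
    assume "1 \<le> n"
    then have "nth_prime n + prime_gap n = nth_prime (n + 1)"
      using nth_prime_less [of n "n + 1"] by (simp add: prime_gap_def)
    moreover have "1 \<le> nth_prime n"
      by (rule prime_ge_1_nat [OF prime_nth_prime])
    ultimately show "2 * prime_gap n
        \<le> primes_between ((nth_prime n)\<^sup>2) ((nth_prime (n + 1))\<^sup>2)"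
      using strong_Legendre_telescoped [OF L, of "nth_prime n" "prime_gap n"] by simp
  qed
next
  assume B: "strong_Brocard"
  show "standard_Brocard"
    unfolding standard_Brocard_def
  proof (intro allI impI)
    fix n :: nat
    assume n: "2 \<le> n"
    have "4 \<le> 2 * prime_gap n"
      using prime_gap_ge_2 [OF n] by simp
    also have "\<dots> \<le> primes_between ((nth_prime n)\<^sup>2) ((nth_prime (n + 1))\<^sup>2)"
      using B n unfolding strong_Brocard_def by simp
    finally show "4 \<le> primes_between ((nth_prime n)\<^sup>2) ((nth_prime (n + 1))\<^sup>2)" .
  qed
qed

end
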